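(* Let $\alpha$ be a positive integer and let $c>1$ be an integer constant. (1) For any leader election algorithm with advice working in time at most $D+\phi+c$ in all feasible graphs of diameter $D$ and election index $\phi$, there exist graphs with election index at most $\alpha$ in which this algorithm requires advice of size $\Omega(\log\alpha)$. (2) For any leader election algorithm with advice working in time at most $D+c\phi$ in all feasible graphs of diameter $D$ and election index $\phi$, there exist graphs with election index at most $\alpha$ in which this algorithm requires advice of size $\Omega(\log\log\alpha)$. (3) For any leader election algorithm with advice working in time at most $D+\phi^{c}$ in all feasible graphs of diameter $D$ and election index $\phi$, there exist graphs with election index at most $\alpha$ in which this algorithm requires advice of size $\Omega(\log\log\log\alpha)$. (4) For any leader election algorithm with advice working in time at most $D+c^{\phi}$ in all feasible graphs of diameter $D$ and election index $\phi$, there exist graphs with election index at most $\alpha$ in which this algorithm requires advice of size $\Omega(\log(\log^*\alpha))$.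
   Context: A graph is a simple undirected connected finite graph whose nodes have no identifiers; at each node $v$ of degree $d$ the incident edges carry distinct port numbers $0,\dots,d-1$ (local to each node). The truncated view $\mathcal{V}^0(v)$ is a single node; $\mathcal{V}^{l+1}(v)$ is the port-labelled rooted tree whose root has, for every neighbour $v_i$ of $v$, a child $x_i$ joined by an edge carrying the same two port numbers as $\{v,v_i\}$ (the one at $v$ at the root side), and $x_i$ is the root of a copy of $\mathcal{V}^l(v_i)$. The augmented truncated view $\mathcal{B}^l(v)$ is $\mathcal{V}^l(v)$ with each leaf labelled by the degree in $G$ of the node it represents. A graph is feasible if for some $l$ the views $\mathcal{B}^l(v)$ of all nodes are pairwise distinct; its election index $\phi$ is the smallest such $l$. Model (LOCAL): synchronous rounds, all nodes start simultaneously, in each round every node exchanges arbitrary messages with all neighbours and computes arbitrarily. Leader election: every node $v$ outputs a sequence $(p_1,q_1,\dots,p_k,q_k)$ of nonnegative integers describing a simple path starting at $v$ whose $i$-th edge has port $p_i$ at its endpoint closer to $v$ and $q_i$ at the other endpoint; all these paths must end at a common node. Time is the number of rounds until all nodes output. Advice: an oracle knowing the entire port-labelled graph gives the same binary string to all nodes before the start; its length is the size of advice. In a deterministic algorithm with advice, the actions/output of node $v$ in round $r$ are a function of the advice and of $\mathcal{B}^r(v)$. $D$ denotes the diameter of the graph. Logarithms are base 2; $\log^*$ is the iterated logarithm; $\Omega(\cdot)$ is asymptotic in $\alpha$. *)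

theory Defs
  imports Complex_Main
begin

section \<open>Port-labelled graphs\<close>

text \<open>A port-labelled graph with nodes 0..nv-1. Node v has degree deg v, and
  nbr v p is the neighbour reached from v through port p (for p < deg v).\<close>

record pgraph =
  nv  :: nat
  deg :: "nat \<Rightarrow> nat"
  nbr :: "nat \<Rightarrow> nat \<Rightarrow> nat"

definition adj :: "pgraph \<Rightarrow> (nat \<times> nat) set" where
  "adj G = {(u, w). u < nv G \<and> (\<exists>p < deg G u. nbr G u p = w)}"

text \<open>Simple, undirected, connected, finite, nonempty; ports at v are 0..deg v - 1
  and are in bijection with the neighbours of v.\<close>
definition wf_pgraph :: "pgraph \<Rightarrow> bool" where
  "wf_pgraph G \<longleftrightarrow>
     nv G \<ge> 1
   \<and> (\<forall>v < nv G. \<forall>p < deg G v. nbr G v p < nv G \<and> nbr G v p \<noteq> v)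
   \<and> (\<forall>v < nv G. inj_on (nbr G v) {..<deg G v})
   \<and> (\<forall>v < nv G. \<forall>p < deg G v. \<exists>q < deg G (nbr G v p). nbr G (nbr G v p) q = v)
   \<and> (\<forall>u < nv G. \<forall>w < nv G. (u, w) \<in> (adj G)\<^sup>*)"

text \<open>Port number at the other endpoint of the edge leaving v by port p.\<close>
definition rport :: "pgraph \<Rightarrow> nat \<Rightarrow> nat \<Rightarrow> nat" where
  "rport G v p = (THE q. q < deg G (nbr G v p) \<and> nbr G (nbr G v p) q = v)"

section \<open>Augmented truncated views\<close>

datatype view = VLeaf nat | VNode "(nat \<times> nat \<times> view) list"

text \<open>aview G l v is B^l(v): leaves carry the degree of the node they represent;
  children of a node are listed in the order of the ports at that node, each edge
  carrying its two port numbers.\<close>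
primrec aview :: "pgraph \<Rightarrow> nat \<Rightarrow> nat \<Rightarrow> view" where
  "aview G 0 v = VLeaf (deg G v)"
| "aview G (Suc l) v =
     VNode (map (\<lambda>p. (p, rport G v p, aview G l (nbr G v p))) [0..<deg G v])"

definition views_distinct :: "pgraph \<Rightarrow> nat \<Rightarrow> bool" where
  "views_distinct G l \<longleftrightarrow>
     (\<forall>u < nv G. \<forall>w < nv G. u \<noteq> w \<longrightarrow> aview G l u \<noteq> aview G l w)"

definition feasible :: "pgraph \<Rightarrow> bool" where
  "feasible G \<longleftrightarrow> wf_pgraph G \<and> (\<exists>l. views_distinct G l)"

definition election_index :: "pgraph \<Rightarrow> nat" where
  "election_index G = (LEAST l. views_distinct G l)"

section \<open>Diameter\<close>

definition gdist :: "pgraph \<Rightarrow> nat \<Rightarrow> nat \<Rightarrow> nat" where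
  "gdist G u w = (LEAST k. (u, w) \<in> adj G ^^ k)"

definition diameter :: "pgraph \<Rightarrow> nat" where
  "diameter G = Max {gdist G u w | u w. u < nv G \<and> w < nv G}"

section \<open>Leader election outputs\<close>

text \<open>walk G v s: for s = (p1,q1,...,pk,qk) returns the list of nodes visited
  starting at v, provided each i-th edge has port p_i at the nearer endpoint and
  q_i at the other endpoint; None otherwise.\<close>
fun walk :: "pgraph \<Rightarrow> nat \<Rightarrow> nat list \<Rightarrow> nat list option" where
  "walk G v [] = Some [v]"
| "walk G v [p] = None"
| "walk G v (p # q # s) =
     (if p < deg G v \<and> rport G v p = q
      then map_option (Cons v) (walk G (nbr G v p) s) else None)"

definition simple_path_to :: "pgraph \<Rightarrow> nat \<Rightarrow> nat list \<Rightarrow> nat \<Rightarrow> bool" where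
  "simple_path_to G v s w \<longleftrightarrow>
     (\<exists>ns. walk G v s = Some ns \<and> distinct ns \<and> last ns = w)"

section \<open>Deterministic algorithms with advice\<close>

text \<open>An algorithm with advice is a pair (adv, alg): the advice map adv maps the whole
  port-labelled graph to a binary string (the same for all nodes); alg A r B gives
  the output (Some s) or no output yet (None) of a node in round r as a function of
  the advice A and of its augmented view B = B^r(v).  A node outputs in the first
  round in which alg returns Some.\<close>

type_synonym advice_map = "pgraph \<Rightarrow> bool list"
type_synonym node_alg = "bool list \<Rightarrow> nat \<Rightarrow> view \<Rightarrow> nat list option"

definition out_round :: "advice_map \<Rightarrow> node_alg \<Rightarrow> pgraph \<Rightarrow> nat \<Rightarrow> nat" where
  "out_round adv alg G v = (LEAST r. alg (adv G) r (aview G r v) \<noteq> None)"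

definition node_output :: "advice_map \<Rightarrow> node_alg \<Rightarrow> pgraph \<Rightarrow> nat \<Rightarrow> nat list" where
  "node_output adv alg G v =
     the (alg (adv G) (out_round adv alg G v) (aview G (out_round adv alg G v) v))"

text \<open>The algorithm performs leader election in G in time at most t.\<close>
definition elects_within :: "advice_map \<Rightarrow> node_alg \<Rightarrow> pgraph \<Rightarrow> nat \<Rightarrow> bool" where
  "elects_within adv alg G t \<longleftrightarrow>
     (\<forall>v < nv G. \<exists>r \<le> t. alg (adv G) r (aview G r v) \<noteq> None)
   \<and> (\<exists>l < nv G. \<forall>v < nv G. simple_path_to G v (node_output adv alg G v) l)"

text \<open>Works in time at most T(D, phi) in all feasible graphs.\<close>
definition LE_in_time :: "advice_map \<Rightarrow> node_alg \<Rightarrow> (nat \<Rightarrow> nat \<Rightarrow> nat) \<Rightarrow> bool" where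
  "LE_in_time adv alg T \<longleftrightarrow>
     (\<forall>G. feasible G \<longrightarrow> elects_within adv alg G (T (diameter G) (election_index G)))"

text \<open>Every algorithm working in time T needs, on some feasible graph with election
  index at most alpha, advice of size Omega(f alpha) (constant uniform in the
  algorithm, asymptotic in alpha).\<close>
definition advice_lower_bound :: "(nat \<Rightarrow> nat \<Rightarrow> nat) \<Rightarrow> (nat \<Rightarrow> real) \<Rightarrow> bool" where
  "advice_lower_bound T f \<longleftrightarrow>
     (\<exists>C > 0. \<exists>\<alpha>0. \<forall>\<alpha> \<ge> \<alpha>0. \<forall>adv alg. LE_in_time adv alg T \<longrightarrow>
        (\<exists>G. feasible G \<and> election_index G \<le> \<alpha> \<and> real (length (adv G)) \<ge> C * f \<alpha>))"

text \<open>Iterated logarithm (base 2).\<close>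
definition log_star :: "real \<Rightarrow> nat" where
  "log_star x = (LEAST k. ((log 2) ^^ k) x \<le> 1)"

end

theory Submission
  imports Defs
begin

text \<open>
  All graphs are blown-up rings whose positions carry labels, coded in the port numbers, so that
  views are windows of the label sequence.  The leader outputs the empty path; hence any node that
  sees a long enough unrolling of the ring around the leader, under the same advice, also elects
  itself.  Call such an unrolled word a trap for that advice.  A ring containing two traps for an
  advice A cannot receive A.  Closing two words over disjoint alphabets, both being traps for
  all advices in a set S, into one ring therefore forces an advice outside S, and unrolling this
  ring around its leader gives a word that is a trap for one more advice: unrolling past the
  antipode keeps one of the two old words intact.  If rings of election index at most \<open>\<phi>\<close> are
  unrolled \<open>g \<phi>\<close> beyond half their length on both sides of the leader, then of any two copies of
  the same position in the word at least one is at distance at most \<open>g \<phi> + 1\<close> from an end of it,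
  so the next ring has election index at most \<open>g \<phi> + 3\<close>.  By pigeonhole, two words with the same
  S always exist; so more than \<open>N\<close> advices are needed as soon as the \<open>N\<close>-fold iterate of
  \<open>\<phi> \<mapsto> g \<phi> + 3\<close> at 2 is at most \<open>\<alpha>\<close>.
\<close>

section \<open>Blown-up labelled rings\<close>

text \<open>For fixed \<open>a\<close> this is the reflection q -> a - q modulo \<open>m\<close>,
  its own inverse on 0..m-1, so one formula gives both the node behind a port and the port towards a
  node.\<close>

definition flip :: "nat \<Rightarrow> nat \<Rightarrow> nat \<Rightarrow> nat" where
  "flip m a q = nat ((int a - int q) mod int m)"

definition lab :: "nat list \<Rightarrow> int \<Rightarrow> nat" where
  "lab w i = w ! nat (i mod int (length w))"

text \<open>The position is an arbitrary integer reduced modulo \<open>n\<close>, so moving either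
  way around the ring needs no wraparound case.\<close>

definition vtx :: "nat \<Rightarrow> nat \<Rightarrow> int \<Rightarrow> nat \<Rightarrow> nat" where
  "vtx m n i j = nat (i mod int n) * m + j"

text \<open>Every position of the ring carries \<open>m\<close> nodes, all adjacent to all nodes of both neighbouring
  positions.  Port \<open>p < m\<close> leads to node \<open>p\<close> of the next position; the ports to the previous
  position are permuted by an involution that depends on the label, which makes the label of a
  position visible as a port number from the position before it.\<close>

definition ring_graph :: "nat \<Rightarrow> nat list \<Rightarrow> pgraph" where
  "ring_graph m w =
     \<lparr> nv = length w * m, deg = (\<lambda>v. 2 * m),
       nbr = (\<lambda>v p. if p < m then vtx m (length w) (int (v div m) + 1) p
         else vtx m (length w) (int (v div m) - 1) (flip m (w ! (v div m)) (p - m))) \<rparr>"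

lemma flip_less: "q < m \<Longrightarrow> flip m a q < m"
  by (simp add: flip_def nat_less_iff)

lemma flip_flip: "q < m \<Longrightarrow> flip m a (flip m a q) = q"
  by (simp add: flip_def mod_diff_right_eq)

text \<open>Adding \<open>q\<close> back recovers the label modulo \<open>m\<close>; hence a single
  reverse port already reveals the whole label.\<close>

lemma flip_inj_label:
  assumes "a < m" "b < m" "flip m a q = flip m b q"
  shows "a = b"
proof -
  have m: "int m > 0" using assms by simp
  have "(int a - int q) mod int m = (int b - int q) mod int m"
    using assms(3) m unfolding flip_def by (metis nat_eq_iff pos_mod_sign int_nat_eq)
  then have "((int a - int q) + int q) mod int m = ((int b - int q) + int q) mod int m"
    by (metis mod_add_left_eq)
  then show ?thesis using assms by simp
qed

lemma vtx_div: "j < m \<Longrightarrow> vtx m n i j div m = nat (i mod int n)"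
  and vtx_mod: "j < m \<Longrightarrow> vtx m n i j mod m = j"
  by (simp_all add: vtx_def)

lemma vtx_less: "j < m \<Longrightarrow> 0 < n \<Longrightarrow> vtx m n i j < n * m"
proof -
  assume j: "j < m" and n: "0 < n"
  have "nat (i mod int n) < n" using n by (simp add: nat_less_iff)
  then have "(nat (i mod int n) + 1) * m \<le> n * m" by (intro mult_right_mono) auto
  then show ?thesis using j by (simp add: vtx_def)
qed

lemma vtx_eq_iff:
  assumes "j < m" "j' < m" "0 < n"
  shows "vtx m n i j = vtx m n i' j' \<longleftrightarrow> i mod int n = i' mod int n \<and> j = j'"
proof
  assume e: "vtx m n i j = vtx m n i' j'"
  have "nat (i mod int n) = nat (i' mod int n)" "j = j'"
    using arg_cong[OF e, of "\<lambda>v. v div m"] arg_cong[OF e, of "\<lambda>v. v mod m"] assms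
    by (simp_all add: vtx_div vtx_mod)
  moreover have "i mod int n \<ge> 0" "i' mod int n \<ge> 0" using assms by simp_all
  ultimately show "i mod int n = i' mod int n \<and> j = j'" by linarith
qed (simp add: vtx_def)

lemma vtx_cong: "i mod int n = i' mod int n \<Longrightarrow> vtx m n i j = vtx m n i' j"
  by (simp add: vtx_def)

lemma ring_graph_simps [simp]:
  "nv (ring_graph m w) = length w * m" "deg (ring_graph m w) v = 2 * m"
  by (simp_all add: ring_graph_def)

lemma ring_node:
  assumes "v < nv (ring_graph m w)"
  shows "\<exists>i j. 0 \<le> i \<and> i < int (length w) \<and> j < m \<and> v = vtx m (length w) i j"
proof (intro exI conjI)
  have v: "v < length w * m" using assms by simp
  then have m: "m > 0" by (cases m) auto
  have d: "v div m < length w" using v by (simp add: less_mult_imp_div_less)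
  show "v = vtx m (length w) (int (v div m)) (v mod m)" using d by (simp add: vtx_def)
  show "v mod m < m" using m by simp
  show "int (v div m) < int (length w)" using d by simp
qed simp

lemma nbr_vtx:
  assumes "j < m" "w \<noteq> []"
  shows "nbr (ring_graph m w) (vtx m (length w) i j) p =
    (if p < m then vtx m (length w) (i + 1) p
     else vtx m (length w) (i - 1) (flip m (lab w i) (p - m)))"
proof -
  have n: "i mod int (length w) \<ge> 0" using assms by simp
  have "vtx m (length w) (i mod int (length w) + 1) p = vtx m (length w) (i + 1) p"
    by (intro vtx_cong) (simp add: mod_simps)
  moreover have "vtx m (length w) (i mod int (length w) - 1) q = vtx m (length w) (i - 1) q" for q
    by (intro vtx_cong) (simp add: mod_simps)
  ultimately show ?thesis using assms n by (simp add: ring_graph_def vtx_div lab_def)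
qed

section \<open>Simplicity, connectivity and diameter of the rings\<close>

lemma mod_succ_neq_pred:
  assumes "(n::int) \<ge> 3"
  shows "(i + 1) mod n \<noteq> (i - 1) mod n"
proof
  assume "(i + 1) mod n = (i - 1) mod n"
  then have "n dvd 2" by (simp add: mod_eq_dvd_iff)
  then show False using assms zdvd_imp_le by fastforce
qed

lemma mod_neighbour_neq:
  assumes "(n::int) \<ge> 3"
  shows "(i + 1) mod n \<noteq> i mod n" "(i - 1) mod n \<noteq> i mod n"
proof -
  show "(i + 1) mod n \<noteq> i mod n"
  proof
    assume "(i + 1) mod n = i mod n"
    then have "n dvd 1" by (simp add: mod_eq_dvd_iff)
    then show False using assms zdvd_imp_le by fastforce
  qed
  show "(i - 1) mod n \<noteq> i mod n"
  proof
    assume "(i - 1) mod n = i mod n"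
    then have "n dvd - 1" by (simp add: mod_eq_dvd_iff)
    then show False using assms zdvd_imp_le by fastforce
  qed
qed

context
  fixes m :: nat and w :: "nat list"
  assumes long: "length w \<ge> 3"
begin

private abbreviation "V \<equiv> vtx m (length w)"
private abbreviation "G \<equiv> ring_graph m w"

lemma nbr_inj:
  assumes "j < m" "p < 2 * m" "q < 2 * m" "nbr G (V i j) p = nbr G (V i j) q"
  shows "p = q"
proof -
  have w: "w \<noteq> []" "0 < length w" using long by auto
  have ne: "(i + 1) mod int (length w) \<noteq> (i - 1) mod int (length w)"
    by (rule mod_succ_neq_pred) (use long in simp)
  consider "p < m" "q < m" | "p < m" "q \<ge> m" | "p \<ge> m" "q < m" | "p \<ge> m" "q \<ge> m"
    by linarith
  then show ?thesis
  proof cases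
    case 4
    then have "p - m < m" "q - m < m" using assms by auto
    then have "flip m (lab w i) (p - m) = flip m (lab w i) (q - m)"
      using assms w 4 by (simp add: nbr_vtx vtx_eq_iff flip_less)
    then have "p - m = q - m"
      using \<open>p - m < m\<close> \<open>q - m < m\<close> by (metis flip_flip)
    then show ?thesis using 4 by simp
  qed (use assms w ne in \<open>auto simp: nbr_vtx vtx_eq_iff flip_less\<close>)
qed

text \<open>The two directions are asymmetric. Going forward, the reverse port depends on the label
  of the position entered; going backward, it is just the index \<open>j\<close>, since a forward
  port is numbered by its target.\<close>

lemma nbr_back:
  fixes i :: int
  assumes "j < m" "p < 2 * m"
  defines "q \<equiv> if p < m then m + flip m (lab w (i + 1)) j else j"
  shows "q < 2 * m" "nbr G (nbr G (V i j) p) q = V i j"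
proof -
  have w: "w \<noteq> []" using long by auto
  show "q < 2 * m" using assms flip_less[of j m] by (auto simp: q_def)
  show "nbr G (nbr G (V i j) p) q = V i j"
    using assms w by (auto simp: nbr_vtx flip_less flip_flip q_def)
qed

lemma rport_vtx:
  assumes "j < m" "p < 2 * m"
  shows "rport G (V i j) p = (if p < m then m + flip m (lab w (i + 1)) j else j)"
proof -
  have w: "w \<noteq> []" using long by auto
  have "\<exists>i' j'. j' < m \<and> nbr G (V i j) p = V i' j'"
  proof (cases "p < m")
    case True
    then show ?thesis using assms w by (auto simp: nbr_vtx)
  next
    case False
    then have "flip m (lab w i) (p - m) < m" using assms by (intro flip_less) auto
    then show ?thesis using assms w False by (auto simp: nbr_vtx)
  qed
  then obtain i' j' where ij: "j' < m" "nbr G (V i j) p = V i' j'" by blast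
  show ?thesis unfolding rport_def
    using nbr_back[OF assms, of i] nbr_inj[of j' _ _ i'] ij
    by (intro the_equality) auto
qed

lemma adj_right:
  assumes "j < m" "j' < m"
  shows "(V i j, V (i + 1) j') \<in> adj G"
proof -
  have w: "w \<noteq> []" "0 < length w" using long by auto
  show ?thesis using assms w by (auto simp: adj_def vtx_less nbr_vtx intro!: exI[of _ j'])
qed

lemma adj_left:
  assumes "j < m" "j' < m"
  shows "(V i j, V (i - 1) j') \<in> adj G"
proof -
  have w: "w \<noteq> []" "0 < length w" using long by auto
  have "nbr G (V i j) (m + flip m (lab w i) j') = V (i - 1) j'"
    using assms w by (subst nbr_vtx) (auto simp: flip_flip)
  then show ?thesis using assms w flip_less[of j' m]
    by (auto simp: adj_def vtx_less intro!: exI[of _ "m + flip m (lab w i) j'"])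
qed

lemma relpow_right:
  assumes "j < m" "j' < m"
  shows "(V i j, V (i + 1 + int k) j') \<in> adj G ^^ Suc k"
  using assms
proof (induction k arbitrary: j')
  case 0
  then show ?case using adj_right by simp
next
  case (Suc k)
  have "(V (i + 1 + int k) j', V (i + 1 + int k + 1) j') \<in> adj G"
    by (rule adj_right) (use Suc in auto)
  then show ?case using Suc.IH[of j'] Suc.prems
    using relpow_Suc_I[of "V i j" "V (i + 1 + int k) j'" "Suc k"]
    by (simp add: algebra_simps del: relpow.simps)
qed

lemma relpow_left:
  assumes "j < m" "j' < m"
  shows "(V i j, V (i - 1 - int k) j') \<in> adj G ^^ Suc k"
  using assms
proof (induction k arbitrary: j')
  case 0
  then show ?case using adj_left by simp
next
  case (Suc k)
  have "(V (i - 1 - int k) j', V (i - 1 - int k - 1) j') \<in> adj G"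
    by (rule adj_left) (use Suc in auto)
  then show ?case using Suc.IH[of j'] Suc.prems
    using relpow_Suc_I[of "V i j" "V (i - 1 - int k) j'" "Suc k"]
    by (simp add: algebra_simps del: relpow.simps)
qed

lemma relpow_short:
  assumes n4: "length w \<ge> 4" and u: "u < nv G" and v: "v < nv G"
  shows "\<exists>k \<le> length w div 2. (u, v) \<in> adj G ^^ k"
proof -
  let ?n = "length w"
  obtain i j where ij: "0 \<le> i" "i < int ?n" "j < m" "u = V i j"
    using u ring_node by blast
  obtain i' j' where ij': "0 \<le> i'" "i' < int ?n" "j' < m" "v = V i' j'"
    using v ring_node by blast
  define d where "d = nat ((i' - i) mod int ?n)"
  have d0: "(i' - i) mod int ?n \<ge> 0" using n4 by (intro pos_mod_sign) auto
  have "(i' - i) mod int ?n < int ?n" using n4 by (intro pos_mod_bound) auto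
  then have dn: "d < ?n" unfolding d_def using d0 by linarith
  have id: "(i + int d) mod int ?n = i' mod int ?n" unfolding d_def using d0
    by (simp add: mod_simps)
  consider "d = 0" | "0 < d" "d \<le> ?n div 2" | "d > ?n div 2" by linarith
  then show ?thesis
  proof cases
    \<comment> \<open>Distinct nodes of one position are not adjacent, so the walk detours through
      the next position. Its length 2 is at most half the ring length because of
      \<open>n4\<close>.\<close>
    case 1
    have "(u, V (i + 1) j) \<in> adj G" using adj_right ij by simp
    moreover have "(V (i + 1) j, V (i + 1 - 1) j') \<in> adj G"
      using adj_left ij(3) ij'(3) by blast
    moreover have "V (i + 1 - 1) j' = v" using id 1 ij' by (simp add: vtx_def)
    ultimately have "(u, v) \<in> adj G ^^ 2" by (auto simp: numeral_2_eq_2)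
    then show ?thesis using n4 by (intro exI[of _ 2]) auto
  next
    case 2
    then have "(u, V (i + 1 + int (d - 1)) j') \<in> adj G ^^ Suc (d - 1)"
      using relpow_right ij ij' by blast
    moreover have "V (i + 1 + int (d - 1)) j' = v"
      unfolding ij'(4) by (rule vtx_cong) (use 2 id in \<open>simp add: of_nat_diff\<close>)
    ultimately show ?thesis using 2 by (intro exI[of _ d]) auto
  next
    case 3
    let ?k = "?n - d"
    have "(u, V (i - 1 - int (?k - 1)) j') \<in> adj G ^^ Suc (?k - 1)"
      using relpow_left ij ij' by blast
    moreover have "V (i - 1 - int (?k - 1)) j' = v"
    proof -
      have "i - 1 - int (?k - 1) = i + int d - int ?n" using dn by (simp add: of_nat_diff)
      then show ?thesis unfolding ij'(4)
        using id minus_mod_self2[of "i + int d" "int ?n"] by (intro vtx_cong) metis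
    qed
    moreover have "Suc (?k - 1) = ?k" using dn by simp
    ultimately have "(u, v) \<in> adj G ^^ ?k" by metis
    then show ?thesis using 3 by (intro exI[of _ ?k]) auto
  qed
qed

lemma wf_ring_graph:
  assumes n4: "length w \<ge> 4" and m: "m \<ge> 1"
  shows "wf_pgraph G"
  unfolding wf_pgraph_def
proof (intro conjI allI impI)
  have w: "w \<noteq> []" "0 < length w" using n4 by auto
  show "1 \<le> nv G" using n4 m by auto
  show "inj_on (nbr G v) {..<deg G v}" if v: "v < nv G" for v
  proof -
    obtain i j where "j < m" "v = V i j" using v ring_node by blast
    then show ?thesis by (intro inj_onI) (rule nbr_inj[of j _ _ i], simp_all)
  qed
  show "\<exists>q < deg G (nbr G v p). nbr G (nbr G v p) q = v" if v: "v < nv G" "p < deg G v" for v p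
  proof -
    obtain i j where "j < m" "v = V i j" using v(1) ring_node by blast
    then show ?thesis using nbr_back[of j p i] v(2) by (simp del: One_nat_def) blast
  qed
  fix v p assume v: "v < nv G" and p: "p < deg G v"
  obtain i j where ij: "j < m" "v = V i j" using v ring_node by blast
  show "nbr G v p < nv G" using ij p w by (auto simp: nbr_vtx vtx_less flip_less)
  have "int (length w) \<ge> 3" using long by simp
  note ne = mod_neighbour_neq[OF this, of i]
  show "nbr G v p \<noteq> v" using ij p w ne by (auto simp: nbr_vtx vtx_eq_iff flip_less)
next
  show "(u, v) \<in> (adj G)\<^sup>*" if "u < nv G" "v < nv G" for u v
    using relpow_short[OF n4 that] relpow_imp_rtrancl by blast
qed

text \<open>An upper bound suffices, as the diameter enters only through the time available to the
  leader.\<close>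

lemma diameter_ring_graph:
  assumes n4: "length w \<ge> 4" and m: "m \<ge> 1"
  shows "diameter G \<le> length w div 2"
proof -
  have eq: "{gdist G u v | u v. u < nv G \<and> v < nv G}
      = (\<lambda>(u, v). gdist G u v) ` ({..<nv G} \<times> {..<nv G})" by auto
  have "nv G > 0" using n4 m by auto
  then have ne: "{..<nv G} \<noteq> {}" by (metis lessThan_iff empty_iff)
  have "gdist G u v \<le> length w div 2" if uv: "u < nv G" "v < nv G" for u v
  proof -
    obtain k where "k \<le> length w div 2" "(u, v) \<in> adj G ^^ k"
      using relpow_short[OF n4 uv] by blast
    then show ?thesis unfolding gdist_def by (meson Least_le order_trans)
  qed
  then show ?thesis unfolding diameter_def eq using ne
    by (intro Max.boundedI) auto
qed

end

section \<open>Unrolled views\<close>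

text \<open>Views in the bi-infinite strip with labels \<open>f\<close>, which covers every ring. No
  ring length occurs, so nodes of different rings become comparable.\<close>

primrec uview :: "nat \<Rightarrow> (int \<Rightarrow> nat) \<Rightarrow> nat \<Rightarrow> int \<Rightarrow> nat \<Rightarrow> view" where
  "uview m f 0 i j = VLeaf (2 * m)"
| "uview m f (Suc r) i j = VNode (map (\<lambda>p.
     if p < m then (p, m + flip m (f (i + 1)) j, uview m f r (i + 1) p)
     else (p, j, uview m f r (i - 1) (flip m (f i) (p - m)))) [0..<2 * m])"

lemma aview_ring_graph:
  assumes "length w \<ge> 3" "j < m"
  shows "aview (ring_graph m w) r (vtx m (length w) i j) = uview m (lab w) r i j"
  using assms(2)
proof (induction r arbitrary: i j)
  case (Suc r)
  have w: "w \<noteq> []" using assms by auto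
  show ?case using Suc w assms(1) flip_less
    by (auto simp: rport_vtx nbr_vtx)
qed simp

text \<open>Each level moves by one position and reads only the labels at \<open>i\<close> and
  \<open>i + 1\<close>, so depth \<open>r\<close> reaches no farther than \<open>r\<close>
  positions.\<close>

lemma uview_cong:
  assumes "\<And>d. \<bar>d\<bar> \<le> int r \<Longrightarrow> f (i + d) = f' (i' + d)"
  shows "uview m f r i j = uview m f' r i' j"
  using assms
proof (induction r arbitrary: i i' j)
  case (Suc r)
  have "uview m f r (i + 1) q = uview m f' r (i' + 1) q" for q
    by (rule Suc.IH) (use Suc.prems[of "1 + _"] in \<open>simp add: add.assoc\<close>)
  moreover have "uview m f r (i - 1) q = uview m f' r (i' - 1) q" for q
    by (rule Suc.IH) (use Suc.prems[of "_ - 1"] in \<open>simp add: algebra_simps\<close>)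
  moreover have "f (i + 1) = f' (i' + 1)" "f i = f' i'"
    using Suc.prems[of 1] Suc.prems[of 0] by auto
  ultimately show ?case by simp
qed simp

text \<open>Decoding one level: port \<open>m\<close>, the first backward one, shows the index
  \<open>j\<close> as its reverse port, and port 0 then shows the label of the next position through
  \<open>flip_inj_label\<close>.\<close>

lemma uview_Suc_eqD:
  assumes m: "m \<ge> 1" and j: "j < m" "j' < m"
    and f: "\<And>z. f z < m" "\<And>z. f' z < m"
    and eq: "uview m f (Suc r) i j = uview m f' (Suc r) i' j'"
  shows "j = j'" "f (i + 1) = f' (i' + 1)"
    "uview m f r (i + 1) 0 = uview m f' r (i' + 1) 0"
    "uview m f r (i - 1) (flip m (f i) 0) = uview m f' r (i' - 1) (flip m (f' i') 0)"
proof -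
  let ?e = "\<lambda>f i j p. if p < m then (p, m + flip m (f (i + 1)) j, uview m f r (i + 1) p)
     else (p, j, uview m f r (i - 1) (flip m (f i) (p - m)))"
  have "map (?e f i j) [0..<2 * m] = map (?e f' i' j') [0..<2 * m]"
    using eq by simp
  then have p: "?e f i j p = ?e f' i' j' p" if "p < 2 * m" for p
    using that by (auto dest!: map_eq_conv[THEN iffD1])
  from p[of m] m show jj: "j = j'"
    and "uview m f r (i - 1) (flip m (f i) 0) = uview m f' r (i' - 1) (flip m (f' i') 0)"
    by auto
  from p[of 0] m have "flip m (f (i + 1)) j = flip m (f' (i' + 1)) j'"
    and "uview m f r (i + 1) 0 = uview m f' r (i' + 1) 0" by auto
  then show "f (i + 1) = f' (i' + 1)" "uview m f r (i + 1) 0 = uview m f' r (i' + 1) 0"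
    using flip_inj_label[of "f (i + 1)" m "f' (i' + 1)" j] f jj by auto
qed

text \<open>Labels become visible on forward edges only. After \<open>r - 1\<close> steps to the
  right the last level shows the label at distance \<open>r\<close>; after \<open>r - 1\<close>
  steps to the left it shows the one at offset \<open>2 - r\<close>. This explains the lopsided
  range.\<close>

lemma uview_eqD:
  assumes m: "m \<ge> 1" and f: "\<And>z. f z < m" "\<And>z. f' z < m"
    and "j < m" "j' < m" "uview m f r i j = uview m f' r i' j'"
    and "2 - int r \<le> d" "d \<le> int r"
  shows "f (i + d) = f' (i' + d)"
  using assms(4-)
proof (induction r arbitrary: i i' j j' d)
  case (Suc r)
  note S = uview_Suc_eqD[OF m Suc.prems(1,2) f Suc.prems(3)]
  have m0: "0 < m" using m by simp
  consider "d = 1" | "d \<ge> 2" | "d \<le> 0" by linarith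
  then show ?case
  proof cases
    case 1
    then show ?thesis using S by simp
  next
    case 2
    then have "f ((i + 1) + (d - 1)) = f' ((i' + 1) + (d - 1))"
      using Suc.prems by (intro Suc.IH[OF m0 m0 S(3)]) auto
    then show ?thesis by simp
  next
    case 3
    then have "f ((i - 1) + (d + 1)) = f' ((i' - 1) + (d + 1))"
      using Suc.prems m0
      by (intro Suc.IH[OF flip_less[OF m0] flip_less[OF m0] S(4)]) auto
    then show ?thesis by simp
  qed
qed simp

section \<open>Words with distinct windows\<close>

text \<open>Only windows lying wholly inside \<open>u\<close> are compared. Positions close to an
  end will be told apart by the foreign letters that follow there once \<open>u\<close> is closed
  into a ring.\<close>

definition seg_distinct :: "nat \<Rightarrow> nat list \<Rightarrow> bool" where
  "seg_distinct \<rho> u \<longleftrightarrow> (\<forall>p q. p + 2 * \<rho> < length u \<longrightarrow> q + 2 * \<rho> < length u \<longrightarrow>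
     (\<forall>d \<le> 2 * \<rho>. u ! (p + d) = u ! (q + d)) \<longrightarrow> p = q)"

definition cyc_distinct :: "nat \<Rightarrow> nat list \<Rightarrow> bool" where
  "cyc_distinct \<rho> w \<longleftrightarrow> (\<forall>i i'. (\<forall>d. \<bar>d\<bar> \<le> int \<rho> \<longrightarrow> lab w (i + d) = lab w (i' + d)) \<longrightarrow>
     i mod int (length w) = i' mod int (length w))"

definition window :: "nat list \<Rightarrow> int \<Rightarrow> nat \<Rightarrow> nat list" where
  "window w i k = map (\<lambda>d. lab w (i + int d)) [0..<k]"

lemma length_window [simp]: "length (window w i k) = k"
  by (simp add: window_def)

lemma nth_window [simp]: "d < k \<Longrightarrow> window w i k ! d = lab w (i + int d)"
  by (simp add: window_def)

lemma lab_mod: "lab w (i mod int (length w) + d) = lab w (i + d)"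
  by (simp add: lab_def mod_simps)

lemma lab_in_set: "w \<noteq> [] \<Longrightarrow> lab w i \<in> set w"
  by (simp add: lab_def nat_less_iff)

lemma lab_append1: "d < length u \<Longrightarrow> lab (u @ u') (int d) = u ! d"
  by (simp add: lab_def nth_append)

lemma lab_append2: "d < length u' \<Longrightarrow> lab (u @ u') (int (length u) + int d) = u' ! d"
  by (simp add: lab_def nth_append nat_add_distrib)

lemma lab_period: "lab w (i + int (length w)) = lab w i" "lab w (i - int (length w)) = lab w i"
  by (simp_all add: lab_def)

text \<open>By \<open>uview_eqD\<close>, depth \<rho> + 2 is what it takes to see \<rho> labels to
  the left. The window then fixes the position, and the top level fixes the index within it.\<close>

lemma views_distinct_ring_graph:
  assumes "length w \<ge> 3" "set w \<subseteq> {..<m}" "cyc_distinct \<rho> w"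
  shows "views_distinct (ring_graph m w) (\<rho> + 2)"
  unfolding views_distinct_def
proof (intro allI impI notI)
  fix u v assume u: "u < nv (ring_graph m w)" and v: "v < nv (ring_graph m w)" and ne: "u \<noteq> v"
    and eq: "aview (ring_graph m w) (\<rho> + 2) u = aview (ring_graph m w) (\<rho> + 2) v"
  obtain i j where ij: "j < m" "u = vtx m (length w) i j"
    using u ring_node by blast
  obtain i' j' where ij': "j' < m" "v = vtx m (length w) i' j'"
    using v ring_node by blast
  have w: "w \<noteq> []" using assms by auto
  have f: "lab w z < m" for z using lab_in_set[OF w, of z] assms by auto
  have m: "m \<ge> 1" using ij by simp
  have eq': "uview m (lab w) (\<rho> + 2) i j = uview m (lab w) (\<rho> + 2) i' j'"
    using eq aview_ring_graph assms(1) ij ij' by metis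
  have "lab w (i + d) = lab w (i' + d)" if "\<bar>d\<bar> \<le> int \<rho>" for d
    by (rule uview_eqD[OF m f f ij(1) ij'(1) eq']) (use that in auto)
  then have "i mod int (length w) = i' mod int (length w)"
    using assms(3) by (auto simp: cyc_distinct_def)
  moreover have "j = j'"
    by (rule uview_Suc_eqD(1)[OF m ij(1) ij'(1) f f, where r = "Suc \<rho>"]) (use eq' in auto)
  ultimately show False using ne ij ij' by (simp add: vtx_def)
qed

text \<open>Let p < q have equal windows. If the window of q ran past the right end, the first
  foreign letter there would face a letter of the block at the same offset from p; likewise for p at
  the left end. So both windows lie inside the block, where \<open>seg_distinct\<close>
  applies.\<close>

lemma block_distinct:
  fixes f :: "int \<Rightarrow> nat" and s :: int
  assumes u: "\<And>d. d < length u \<Longrightarrow> f (s + int d) = u ! d" and X: "set u \<subseteq> X"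
    and out: "f (s - 1) \<notin> X" "f (s + int (length u)) \<notin> X" and sd: "seg_distinct \<rho> u"
    and p: "s \<le> p" "p < s + int (length u)" and q: "s \<le> q" "q < s + int (length u)"
    and eq: "\<And>d. \<bar>d\<bar> \<le> int \<rho> \<Longrightarrow> f (p + d) = f (q + d)"
  shows "p = q"
  using p q eq
proof (induction p q rule: linorder_wlog)
  case (le p q)
  have inX: "f z \<in> X" if "s \<le> z" "z < s + int (length u)" for z
  proof -
    have "f (s + int (nat (z - s))) = u ! nat (z - s)" by (rule u) (use that in auto)
    moreover have "nat (z - s) < length u" using that by auto
    ultimately show ?thesis using that X by (auto dest: nth_mem)
  qed
  show ?case
  proof (rule ccontr)
    assume "p \<noteq> q"
    then have pq: "p < q" using le by simp
    have 1: "q + int \<rho> < s + int (length u)"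
    proof (rule ccontr)
      assume "\<not> ?thesis"
      then have "f (p + (s + int (length u) - q)) = f (q + (s + int (length u) - q))"
        using le.prems(1-4) by (intro le.prems(5)) auto
      then show False using inX[of "p + (s + int (length u) - q)"] out(2) pq le.prems(1-4) by auto
    qed
    have 2: "s + int \<rho> \<le> p"
    proof (rule ccontr)
      assume "\<not> ?thesis"
      then have "f (p + (s - 1 - p)) = f (q + (s - 1 - p))"
        using le.prems(1-4) by (intro le.prems(5)) auto
      then show False using inX[of "q + (s - 1 - p)"] out(1) pq le.prems(1-4) by auto
    qed
    \<comment> \<open>Starting points of the two windows, relative to the block, since
      \<open>seg_distinct\<close> indexes windows by their left end rather than by their
      centre.\<close>
    define p0 where "p0 = nat (p - int \<rho> - s)"
    define q0 where "q0 = nat (q - int \<rho> - s)"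
    have p0: "int p0 = p - int \<rho> - s" and q0: "int q0 = q - int \<rho> - s"
      using 2 pq by (auto simp: p0_def q0_def)
    have len: "p0 + 2 * \<rho> < length u" "q0 + 2 * \<rho> < length u" using 1 p0 q0 pq by linarith+
    have "u ! (p0 + d) = u ! (q0 + d)" if "d \<le> 2 * \<rho>" for d
    proof -
      have "u ! (p0 + d) = f (s + int (p0 + d))" using len that by (intro u[symmetric]) auto
      also have "\<dots> = f (p + (int d - int \<rho>))" using p0 by (intro arg_cong[of _ _ f]) simp
      also have "\<dots> = f (q + (int d - int \<rho>))" using that by (intro le.prems(5)) auto
      also have "\<dots> = f (s + int (q0 + d))" using q0 by (intro arg_cong[of _ _ f]) simp
      also have "\<dots> = u ! (q0 + d)" using len that by (intro u) auto
      finally show ?thesis .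
    qed
    then have "p0 = q0" using sd len unfolding seg_distinct_def by blast
    then show False using p0 q0 pq by simp
  qed
next
  case (sym p q)
  then show ?case by (metis (no_types, lifting))
qed

text \<open>The letter at the centre tells which word the position belongs to, the alphabets being
  disjoint. Each word is bordered on both sides by letters of the other, so
  \<open>block_distinct\<close> finishes.\<close>

lemma cyc_distinct_append:
  assumes ne: "u \<noteq> []" "u' \<noteq> []" and dis: "set u \<inter> set u' = {}"
    and sd: "seg_distinct \<rho> u" "seg_distinct \<rho> u'"
  shows "cyc_distinct \<rho> (u @ u')"
  unfolding cyc_distinct_def
proof (intro allI impI)
  fix i i' assume eq: "\<forall>d. \<bar>d\<bar> \<le> int \<rho> \<longrightarrow> lab (u @ u') (i + d) = lab (u @ u') (i' + d)"
  let ?w = "u @ u'" and ?n = "int (length (u @ u'))"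
  define p where "p = i mod ?n"
  define q where "q = i' mod ?n"
  have n: "?n > 0" using ne by (cases u) auto
  have p: "0 \<le> p" "p < ?n" and q: "0 \<le> q" "q < ?n" using n by (auto simp: p_def q_def)
  have eq: "lab ?w (p + d) = lab ?w (q + d)" if "\<bar>d\<bar> \<le> int \<rho>" for d
    using eq that unfolding p_def q_def lab_mod by blast
  have u: "lab ?w (0 + int d) = u ! d" if "d < length u" for d using lab_append1[OF that] by simp
  have u': "lab ?w (int (length u) + int d) = u' ! d" if "d < length u'" for d
    using lab_append2[OF that] by simp
  have in1: "lab ?w z \<in> set u" if "0 \<le> z" "z < int (length u)" for z
    using u[of "nat z"] that by (auto simp: nat_less_iff)
  have in2: "lab ?w z \<in> set u'" if "int (length u) \<le> z" "z < ?n" for z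
  proof -
    have l: "nat (z - int (length u)) < length u'" using that by auto
    show ?thesis using u'[OF l] nth_mem[OF l] that by simp
  qed
  have o1: "lab ?w (0 - 1) \<notin> set u"
    using lab_period(1)[of ?w "-1"] in2[of "?n - 1"] ne dis by (auto simp: add.commute)
  have o2: "lab ?w (0 + int (length u)) \<notin> set u"
    using in2[of "int (length u)"] ne dis by auto
  have o3: "lab ?w (int (length u) - 1) \<notin> set u'"
    using in1[of "int (length u) - 1"] ne dis by (auto simp: Suc_leI)
  have o4: "lab ?w (int (length u) + int (length u')) \<notin> set u'"
    using lab_period(1)[of ?w 0] in1[of 0] ne dis by auto
  have c: "lab ?w p = lab ?w q" using eq[of 0] by simp
  consider "p < int (length u)" "q < int (length u)" | "int (length u) \<le> p" "int (length u) \<le> q"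
    using c in1[OF p(1)] in2[OF _ p(2)] in1[OF q(1)] in2[OF _ q(2)] dis
    by (metis disjoint_iff not_le)
  then have "p = q"
  proof cases
    case 1
    show ?thesis
      by (rule block_distinct[OF u subset_refl o1 o2 sd(1)]) (use 1 p q eq in auto)
  next
    case 2
    show ?thesis
      by (rule block_distinct[OF u' subset_refl o3 o4 sd(2)]) (use 2 p q eq in auto)
  qed
  then show "i mod ?n = i' mod ?n" by (simp add: p_def q_def)
qed

section \<open>Unrolling a ring into a word\<close>

text \<open>Windows of radius \<gamma> + 1 fit only at starts below
  \<open>2 * (length w div 2) - 1\<close>, hence less than one period apart, while equal windows
  start at congruent positions. Radius \<gamma> could admit two starts exactly one period
  apart.\<close>

lemma seg_distinct_window:
  assumes w: "w \<noteq> []" and cd: "cyc_distinct \<rho> w" and \<rho>: "\<rho> \<le> \<gamma> + 1"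
  shows "seg_distinct (\<gamma> + 1) (window w i (2 * (length w div 2 + \<gamma>) + 1))"
  unfolding seg_distinct_def
proof (intro allI impI)
  let ?n = "length w" and ?k = "2 * (length w div 2 + \<gamma>) + 1"
  fix p q
  assume "p + 2 * (\<gamma> + 1) < length (window w i ?k)" "q + 2 * (\<gamma> + 1) < length (window w i ?k)"
  then have p: "p + 2 * (\<gamma> + 1) < ?k" and q: "q + 2 * (\<gamma> + 1) < ?k" by simp_all
  assume eq: "\<forall>d \<le> 2 * (\<gamma> + 1). window w i ?k ! (p + d) = window w i ?k ! (q + d)"
  let ?P = "i + int p + int (\<gamma> + 1)" and ?Q = "i + int q + int (\<gamma> + 1)"
  have "lab w (?P + d) = lab w (?Q + d)" if d: "\<bar>d\<bar> \<le> int \<rho>" for d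
  proof -
    define e where "e = nat (d + int (\<gamma> + 1))"
    have e: "int e = d + int (\<gamma> + 1)" "e \<le> 2 * (\<gamma> + 1)" using d \<rho> by (auto simp: e_def)
    have "window w i ?k ! (p + e) = window w i ?k ! (q + e)" using eq e by blast
    then have "lab w (i + int (p + e)) = lab w (i + int (q + e))"
      using e p q by simp
    then show ?thesis using e by (simp add: algebra_simps)
  qed
  then have "?P mod int ?n = ?Q mod int ?n" using cd unfolding cyc_distinct_def by blast
  then have dv: "int ?n dvd int p - int q" by (simp add: mod_eq_dvd_iff)
  have "2 * (?n div 2) \<le> ?n" by simp
  then have "p < ?n" "q < ?n" using p q by simp_all
  then have "\<bar>int p - int q\<bar> < int ?n" by linarith
  then show "p = q" using dv dvd_imp_le_int[of "int p - int q" "int ?n"] by fastforce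
qed

text \<open>A full turn starting inside \<open>u\<close> (or right at its end) runs through all of
  \<open>u'\<close> before closing; one starting inside \<open>u'\<close> runs through all of the
  next copy of \<open>u\<close>.\<close>

lemma window_contains_half:
  assumes "u \<noteq> []" and k: "length (u @ u') \<le> k"
  shows "\<exists>xs ys. window (u @ u') i k = xs @ u @ ys \<or> window (u @ u') i k = xs @ u' @ ys"
proof -
  let ?w = "u @ u'"
  let ?n = "length ?w"
  have sub: "window ?w i k = take s (window ?w i k) @ v @ drop (s + length v) (window ?w i k)"
    if "s + length v \<le> k" "\<And>d. d < length v \<Longrightarrow> lab ?w (i + int s + int d) = v ! d" for s v
  proof -
    have "take (length v) (drop s (window ?w i k)) = v"
      using that by (intro nth_equalityI) (auto simp: add.assoc)
    then show ?thesis
      by (metis append_take_drop_id drop_drop add.commute)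
  qed
  define t where "t = nat (i mod int ?n)"
  have n: "int ?n > 0" using assms by (cases u) auto
  have t: "int t = i mod int ?n" unfolding t_def using pos_mod_sign[OF n, of i] by linarith
  then have tn: "t < ?n" using pos_mod_bound[OF n, of i] by linarith
  have L: "lab ?w (i + z) = lab ?w (int t + z)" for z using lab_mod[of ?w i z] t by simp
  show ?thesis
  proof (cases "t \<le> length u")
    case True
    have "window ?w i k = take (length u - t) (window ?w i k) @ u' @
        drop (length u - t + length u') (window ?w i k)"
    proof (rule sub)
      show "length u - t + length u' \<le> k" using k by simp
      fix d assume d: "d < length u'"
      have "lab ?w (i + int (length u - t) + int d) = lab ?w (int (length u) + int d)"
        using L[of "int (length u - t) + int d"] True by (simp add: of_nat_diff add.assoc)
      then show "lab ?w (i + int (length u - t) + int d) = u' ! d" using lab_append2[OF d] by simp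
    qed
    then show ?thesis by blast
  next
    case False
    have "window ?w i k = take (?n - t) (window ?w i k) @ u @
        drop (?n - t + length u) (window ?w i k)"
    proof (rule sub)
      show "?n - t + length u \<le> k" using k False by simp
      fix d assume d: "d < length u"
      have "int t + (int (?n - t) + int d) = int d + int ?n" using tn by (simp add: of_nat_diff)
      then have "lab ?w (i + int (?n - t) + int d) = lab ?w (int d)"
        using L[of "int (?n - t) + int d"] lab_period(1)[of ?w "int d"] by (metis add.assoc)
      then show "lab ?w (i + int (?n - t) + int d) = u ! d" using lab_append1[OF d] by simp
    qed
    then show ?thesis by blast
  qed
qed

section \<open>Traps\<close>

text \<open>Quantifying over all \<open>f\<close> makes the behaviour portable: under advice
  \<open>A\<close> the node at offset \<open>off\<close> first outputs at time \<open>t\<close>, and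
  outputs the empty path, in every ring containing \<open>u\<close>, whatever surrounds it.\<close>

definition trap :: "nat \<Rightarrow> node_alg \<Rightarrow> bool list \<Rightarrow> nat list \<Rightarrow> bool" where
  "trap m alg A u \<longleftrightarrow> (\<exists>off < length u. \<exists>j < m. \<exists>t. \<forall>f i.
     (\<forall>d < length u. f (i + int d) = u ! d) \<longrightarrow>
       alg A t (uview m f t (i + int off) j) = Some []
     \<and> (\<forall>s < t. alg A s (uview m f s (i + int off) j) = None))"

lemma trap_append:
  assumes "trap m alg A u"
  shows "trap m alg A (xs @ u @ ys)"
proof -
  obtain off j t where off: "off < length u" "j < m"
    and T: "\<And>f i. (\<forall>d < length u. f (i + int d) = u ! d) \<Longrightarrow>
       alg A t (uview m f t (i + int off) j) = Some []
     \<and> (\<forall>s < t. alg A s (uview m f s (i + int off) j) = None)"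
    using assms unfolding trap_def by blast
  have "alg A t (uview m f t (i + int (length xs + off)) j) = Some []
     \<and> (\<forall>s < t. alg A s (uview m f s (i + int (length xs + off)) j) = None)"
    if f: "\<forall>d < length (xs @ u @ ys). f (i + int d) = (xs @ u @ ys) ! d" for f i
  proof -
    have "\<forall>d < length u. f ((i + int (length xs)) + int d) = u ! d"
    proof (intro allI impI)
      fix d assume "d < length u"
      then show "f ((i + int (length xs)) + int d) = u ! d"
        using f[rule_format, of "length xs + d"] by (simp add: nth_append add.assoc)
    qed
    from T[OF this] show ?thesis by (simp add: add.assoc)
  qed
  moreover have "length xs + off < length (xs @ u @ ys)" using off by simp
  ultimately show ?thesis using off unfolding trap_def by blast
qed

section \<open>Empty outputs and self-election\<close>

lemma walk_Some:
  assumes "walk G v s = Some ns"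
  shows "\<exists>ns'. ns = v # ns' \<and> (s = [] \<longleftrightarrow> ns' = [])"
  using assms
proof (induction G v s arbitrary: ns rule: walk.induct)
  case (3 G v p q s)
  then show ?case by (fastforce split: if_splits)
qed auto

text \<open>A nonempty walk back to its start repeats that node. Applied to the leader, this forces
  the empty output.\<close>

lemma simple_path_to_self:
  assumes "simple_path_to G v s v"
  shows "s = []"
proof -
  obtain ns where ns: "walk G v s = Some ns" "distinct ns" "last ns = v"
    using assms unfolding simple_path_to_def by blast
  obtain ns' where ns': "ns = v # ns'" "s = [] \<longleftrightarrow> ns' = []" using walk_Some[OF ns(1)] by blast
  have "ns' = []"
  proof (rule ccontr)
    assume "ns' \<noteq> []"
    then have "v \<in> set ns'" using ns(3) ns'(1) last_in_set[of ns'] by simp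
    then show False using ns(2) ns'(1) by simp
  qed
  then show ?thesis using ns' by simp
qed

lemma simple_path_to_Nil: "simple_path_to G v [] l \<Longrightarrow> l = v"
  by (auto simp: simple_path_to_def)

lemma out_round_eqI:
  assumes "alg (adv G) t (aview G t v) \<noteq> None" "\<And>s. s < t \<Longrightarrow> alg (adv G) s (aview G s v) = None"
  shows "out_round adv alg G v = t"
  unfolding out_round_def using assms by (intro Least_equality) (auto intro: leI)

text \<open>Under advice \<open>A\<close> each trap would supply a node electing itself, one at a
  position of \<open>u\<close> and one at a position of \<open>u'\<close>, while the elected node is
  unique.\<close>

lemma two_traps:
  assumes el: "elects_within adv alg (ring_graph m (u @ u')) T"
    and len: "length (u @ u') \<ge> 3"
    and tr: "trap m alg A u" "trap m alg A u'"
  shows "adv (ring_graph m (u @ u')) \<noteq> A"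
proof
  let ?w = "u @ u'"
  let ?G = "ring_graph m ?w"
  assume A: "adv ?G = A"
  have leader: "\<exists>off j. off < length v \<and> j < m \<and>
      node_output adv alg ?G (vtx m (length ?w) (i + int off) j) = []"
    if tv: "trap m alg A v" and f: "\<forall>d < length v. lab ?w (i + int d) = v ! d" for v i
  proof -
    obtain off j t where off: "off < length v" "j < m"
      and T: "alg A t (uview m (lab ?w) t (i + int off) j) = Some []"
        "\<forall>s < t. alg A s (uview m (lab ?w) s (i + int off) j) = None"
      using tv f unfolding trap_def by blast
    let ?v = "vtx m (length ?w) (i + int off) j"
    have "out_round adv alg ?G ?v = t"
      by (rule out_round_eqI) (use T A aview_ring_graph[OF len off(2)] in auto)
    then have "node_output adv alg ?G ?v = []"
      unfolding node_output_def using T A aview_ring_graph[OF len off(2)] by simp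
    then show ?thesis using off by blast
  qed
  obtain l where l: "\<And>v. v < nv ?G \<Longrightarrow> simple_path_to ?G v (node_output adv alg ?G v) l"
    using el unfolding elects_within_def by blast
  have pos: "0 < length ?w" using len by linarith
  have to_l: "l = vtx m (length ?w) i j"
    if "j < m" "node_output adv alg ?G (vtx m (length ?w) i j) = []" for i j
    using l[of "vtx m (length ?w) i j"] that vtx_less[OF that(1) pos, of i] simple_path_to_Nil
    by auto
  obtain off j where 1: "off < length u" "j < m"
      "node_output adv alg ?G (vtx m (length ?w) (0 + int off) j) = []"
    using leader[OF tr(1), of 0] lab_append1[of _ u u'] by auto
  obtain off' j' where 2: "off' < length u'" "j' < m"
      "node_output adv alg ?G (vtx m (length ?w) (int (length u) + int off') j') = []"
    using leader[OF tr(2), of "int (length u)"] lab_append2[of _ u' u] by auto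
  have "vtx m (length ?w) (0 + int off) j = vtx m (length ?w) (int (length u) + int off') j'"
    using to_l[OF 1(2,3)] to_l[OF 2(2,3)] by simp
  then have "(0 + int off) mod int (length ?w) = (int (length u) + int off') mod int (length ?w)"
    using vtx_eq_iff[OF 1(2) 2(2) pos] by blast
  then show False using 1(1) 2(1) by simp
qed

text \<open>The leader decides by time \<open>T\<close>, so everything it does is determined by the
  labels within \<open>R\<close> of it. The window is centred at the leader, which therefore sits at
  offset \<open>R\<close>.\<close>

lemma leader_trap:
  assumes el: "elects_within adv alg (ring_graph m w) T" and len: "length w \<ge> 3" and R: "T \<le> R"
  shows "\<exists>i. trap m alg (adv (ring_graph m w)) (window w i (2 * R + 1))"
proof -
  let ?G = "ring_graph m w"
  let ?A = "adv ?G"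
  obtain l where ln: "l < nv ?G" and l: "simple_path_to ?G l (node_output adv alg ?G l) l"
    using el unfolding elects_within_def by blast
  obtain i j where ij: "j < m" "l = vtx m (length w) i j"
    using ln ring_node by blast
  define t where "t = out_round adv alg ?G l"
  obtain r where r: "r \<le> T" "alg ?A r (aview ?G r l) \<noteq> None"
    using el ln unfolding elects_within_def by blast
  have t: "t \<le> T" "alg ?A t (aview ?G t l) \<noteq> None"
    unfolding t_def out_round_def using r
    by (meson Least_le order_trans, metis (mono_tags, lifting) LeastI)
  have before: "alg ?A s (aview ?G s l) = None" if "s < t" for s
    using not_less_Least[of s "\<lambda>r. alg ?A r (aview ?G r l) \<noteq> None"] that
    unfolding t_def out_round_def by blast
  have out: "alg ?A t (aview ?G t l) = Some []"
    using t simple_path_to_self[OF l] unfolding node_output_def t_def[symmetric] by auto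
  have "alg ?A t (uview m f t (i' + int R) j) = Some []
      \<and> (\<forall>s < t. alg ?A s (uview m f s (i' + int R) j) = None)"
    if occ: "\<forall>d < length (window w (i - int R) (2 * R + 1)).
      f (i' + int d) = window w (i - int R) (2 * R + 1) ! d" for f i'
  proof -
    have f: "f (i' + int d) = lab w (i - int R + int d)" if "d < 2 * R + 1" for d
      using occ that by simp
    have same: "uview m f s (i' + int R) j = aview ?G s l" if "s \<le> R" for s
    proof -
      have "uview m f s (i' + int R) j = uview m (lab w) s i j"
      proof (rule uview_cong)
        fix d assume "\<bar>d\<bar> \<le> int s"
        then have d: "int (nat (int R + d)) = int R + d" "nat (int R + d) < 2 * R + 1"
          using that by auto
        show "f (i' + int R + d) = lab w (i + d)"
          using f[OF d(2)] unfolding d(1) by (simp add: algebra_simps)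
      qed
      then show ?thesis using aview_ring_graph[OF len ij(1)] ij(2) by simp
    qed
    show ?thesis using same t R out before by simp
  qed
  moreover have "R < length (window w (i - int R) (2 * R + 1))" by simp
  ultimately have "trap m alg ?A (window w (i - int R) (2 * R + 1))"
    using ij(1) unfolding trap_def by blast
  then show ?thesis by blast
qed

section \<open>Chains of traps\<close>

text \<open>Bound on the election index of the ring built in round \<open>k\<close>: words with
  distinct windows of radius \<rho> give index at most \<rho> + 2, and unrolling that ring gives
  words of radius \<open>g (\<rho> + 2) + 1\<close>.\<close>

primrec phi :: "(nat \<Rightarrow> nat) \<Rightarrow> nat \<Rightarrow> nat" where
  "phi g 0 = 2"
| "phi g (Suc k) = g (phi g k) + 3"

lemma phi_ge_2: "phi g k \<ge> 2"
  by (cases k) auto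

lemma phi_mono:
  assumes "\<And>x. x \<le> g x" and "i \<le> k"
  shows "phi g i \<le> phi g k"
  using assms(2)
proof (rule lift_Suc_mono_le[rotated])
  show "phi g n \<le> phi g (Suc n)" for n using assms(1)[of "phi g n"] by simp
qed

text \<open>Length at least 2 ensures that two such words close into a ring of at least 4
  positions.\<close>

definition chain_word :: "nat \<Rightarrow> node_alg \<Rightarrow> nat \<Rightarrow> bool list set \<Rightarrow> nat set \<Rightarrow> nat list \<Rightarrow> bool" where
  "chain_word m alg \<rho> S X u \<longleftrightarrow> set u \<subseteq> X \<and> length u \<ge> 2 \<and> seg_distinct \<rho> u \<and>
     (\<forall>A \<in> S. trap m alg A u)"

text \<open>Monotonicity of \<open>g\<close> turns the index bound into a time bound. The condition
  \<open>x \<le> g x\<close> makes the new radius at least the old one, as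
  \<open>seg_distinct_window\<close> demands.\<close>

lemma chain_word_step:
  assumes LE: "LE_in_time adv alg (\<lambda>D \<phi>. D + g \<phi>)" and g: "mono g" "\<And>x. x \<le> g x"
    and X: "X \<subseteq> {..<m}" "X' \<subseteq> {..<m}" "X \<inter> X' = {}"
    and u: "chain_word m alg \<rho> S X u" and u': "chain_word m alg \<rho> S X' u'"
  shows "\<exists>G v. feasible G \<and> election_index G \<le> \<rho> + 2 \<and> adv G \<notin> S \<and>
    chain_word m alg (g (\<rho> + 2) + 1) (insert (adv G) S) (X \<union> X') v"
proof -
  let ?w = "u @ u'"
  let ?G = "ring_graph m ?w"
  have len: "length ?w \<ge> 4" "length ?w \<ge> 3" and ne: "u \<noteq> []" "u' \<noteq> []"
    using u u' by (auto simp: chain_word_def)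
  have sub: "set ?w \<subseteq> {..<m}" "set ?w \<subseteq> X \<union> X'" using u u' X by (auto simp: chain_word_def)
  have m: "m \<ge> 1" using sub ne by (cases u) auto
  have cd: "cyc_distinct \<rho> ?w"
    using u u' X by (intro cyc_distinct_append ne) (auto simp: chain_word_def)
  have vd: "views_distinct ?G (\<rho> + 2)" using views_distinct_ring_graph[OF len(2) sub(1) cd] .
  have feas: "feasible ?G"
    unfolding feasible_def using wf_ring_graph[OF len(2,1) m] vd by blast
  have idx: "election_index ?G \<le> \<rho> + 2" unfolding election_index_def using vd by (rule Least_le)
  define \<gamma> where "\<gamma> = g (\<rho> + 2)"
  have el: "elects_within adv alg ?G (diameter ?G + g (election_index ?G))"
    using LE feas unfolding LE_in_time_def by blast
  have R: "diameter ?G + g (election_index ?G) \<le> length ?w div 2 + \<gamma>"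
    unfolding \<gamma>_def by (rule add_mono[OF diameter_ring_graph[OF len(2,1) m] monoD[OF g(1) idx]])
  obtain i where new: "trap m alg (adv ?G) (window ?w i (2 * (length ?w div 2 + \<gamma>) + 1))"
    using leader_trap[OF el len(2) R] by blast
  let ?v = "window ?w i (2 * (length ?w div 2 + \<gamma>) + 1)"
  have notin: "adv ?G \<notin> S"
    using two_traps[OF el len(2)] u u' unfolding chain_word_def by blast
  have vlen: "length ?w \<le> 2 * (length ?w div 2 + \<gamma>) + 1" by presburger
  have old: "trap m alg A ?v" if "A \<in> S" for A
  proof -
    have "trap m alg A u" "trap m alg A u'" using that u u' by (auto simp: chain_word_def)
    moreover obtain xs ys where "?v = xs @ u @ ys \<or> ?v = xs @ u' @ ys"
      using window_contains_half[OF ne(1) vlen, of i] by blast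
    ultimately show ?thesis using trap_append[of m alg A] by auto
  qed
  have "set ?v \<subseteq> set ?w" using ne lab_in_set[of ?w] by (auto simp: window_def)
  moreover have "seg_distinct (\<gamma> + 1) ?v"
    by (rule seg_distinct_window[OF _ cd]) (use ne g(2)[of "\<rho> + 2"] in \<open>auto simp: \<gamma>_def\<close>)
  ultimately have "chain_word m alg (\<gamma> + 1) (insert (adv ?G) S) (X \<union> X') ?v"
    using new old sub vlen len unfolding chain_word_def by auto
  then show ?thesis using feas idx notin unfolding \<gamma>_def by blast
qed

section \<open>Pigeonhole over disjoint alphabets\<close>

lemma disjoint_pieces:
  assumes "finite X" "card X \<ge> k * b"
  obtains Y :: "nat \<Rightarrow> 'a set" where "\<And>i. i < k \<Longrightarrow> Y i \<subseteq> X" "\<And>i. i < k \<Longrightarrow> card (Y i) = b"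
    "\<And>i i'. i < k \<Longrightarrow> i' < k \<Longrightarrow> i \<noteq> i' \<Longrightarrow> Y i \<inter> Y i' = {}"
proof -
  have "\<exists>Y :: nat \<Rightarrow> 'a set. (\<forall>i < k. Y i \<subseteq> X \<and> card (Y i) = b) \<and>
      (\<forall>i < k. \<forall>i' < k. i \<noteq> i' \<longrightarrow> Y i \<inter> Y i' = {})"
    using assms
  proof (induction k arbitrary: X)
    case (Suc k)
    obtain Z where Z: "Z \<subseteq> X" "card Z = b" "finite Z"
      using Suc.prems obtain_subset_with_card_n[of b X] by auto
    have "k * b \<le> card (X - Z)" using Suc.prems Z by (simp add: card_Diff_subset)
    then obtain Y where Y: "\<forall>i < k. Y i \<subseteq> X - Z \<and> card (Y i) = b"
      "\<forall>i < k. \<forall>i' < k. i \<noteq> i' \<longrightarrow> Y i \<inter> Y i' = {}"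
      using Suc.IH[of "X - Z"] Suc.prems by blast
    show ?case
      by (rule exI[of _ "Y(k := Z)"]) (use Y Z in \<open>auto simp: less_Suc_eq\<close>)
  qed auto
  then obtain Y :: "nat \<Rightarrow> 'a set" where Y: "\<forall>i < k. Y i \<subseteq> X \<and> card (Y i) = b"
    "\<forall>i < k. \<forall>i' < k. i \<noteq> i' \<longrightarrow> Y i \<inter> Y i' = {}" by blast
  show ?thesis by (rule that[of Y]) (use Y in simp_all)
qed

text \<open>Induction on the number of trapped advices. The threshold \<open>b\<close> is chosen
  before the alphabet, so the hypothesis can be applied to many disjoint alphabets at once.\<close>

lemma chain_words_exist:
  assumes LE: "LE_in_time adv alg (\<lambda>D \<phi>. D + g \<phi>)" and g: "mono g" "\<And>x. x \<le> g x"
    and fin: "finite \<A>"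
    and adv: "\<And>G. feasible G \<Longrightarrow> election_index G \<le> \<alpha> \<Longrightarrow> adv G \<in> \<A>"
    and k: "\<And>i. i < k \<Longrightarrow> phi g i \<le> \<alpha>"
  shows "\<exists>b. \<forall>m X. X \<subseteq> {..<m} \<longrightarrow> card X \<ge> b \<longrightarrow>
    (\<exists>S \<subseteq> \<A>. card S = k \<and> (\<exists>u. chain_word m alg (phi g k - 2) S X u))"
  using k
proof (induction k)
  case 0
  have "\<exists>u. chain_word m alg 0 {} X u" if X: "card X \<ge> 2" for m and X :: "nat set"
  proof -
    obtain x y where xy: "x \<in> X" "y \<in> X" "x \<noteq> y"
      using X by (metis card_2_iff' obtain_subset_with_card_n subset_iff)
    have "seg_distinct 0 [x, y]"
      unfolding seg_distinct_def using xy by (auto simp: less_Suc_eq)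
    then show ?thesis using xy by (intro exI[of _ "[x, y]"]) (auto simp: chain_word_def)
  qed
  then show ?case by (intro exI[of _ 2]) (auto intro!: exI[of _ "{}"])
next
  case (Suc k)
  obtain b where b: "\<And>m X. X \<subseteq> {..<m} \<Longrightarrow> card X \<ge> b \<Longrightarrow>
    (\<exists>S \<subseteq> \<A>. card S = k \<and> (\<exists>u. chain_word m alg (phi g k - 2) S X u))"
    using Suc.IH Suc.prems by (metis less_SucI)
  \<comment> \<open>One more piece than there are subsets of \<open>\<A>\<close>, so two pieces must
    carry the same set \<open>S\<close>.\<close>
  define K where "K = Suc (card (Pow \<A>))"
  have "\<exists>S \<subseteq> \<A>. card S = Suc k \<and> (\<exists>u. chain_word m alg (phi g (Suc k) - 2) S X u)"
    if X: "X \<subseteq> {..<m}" "card X \<ge> K * b" for m X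
  proof -
    have finX: "finite X" using X finite_subset by blast
    obtain Y where Y: "\<And>i. i < K \<Longrightarrow> Y i \<subseteq> X" "\<And>i. i < K \<Longrightarrow> card (Y i) = b"
      "\<And>i i'. i < K \<Longrightarrow> i' < K \<Longrightarrow> i \<noteq> i' \<Longrightarrow> Y i \<inter> Y i' = {}"
      using disjoint_pieces[OF finX X(2)] by blast
    have "\<forall>i \<in> {..<K}. \<exists>S. S \<subseteq> \<A> \<and> card S = k \<and> (\<exists>u. chain_word m alg (phi g k - 2) S (Y i) u)"
    proof
      fix i assume "i \<in> {..<K}"
      then have "Y i \<subseteq> {..<m}" "b \<le> card (Y i)" using Y(1,2)[of i] X(1) by auto
      from b[OF this] show "\<exists>S. S \<subseteq> \<A> \<and> card S = k \<and> (\<exists>u. chain_word m alg (phi g k - 2) S (Y i) u)"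
        by blast
    qed
    from bchoice[OF this] obtain S where S: "\<And>i. i < K \<Longrightarrow> S i \<subseteq> \<A>" "\<And>i. i < K \<Longrightarrow> card (S i) = k"
      "\<And>i. i < K \<Longrightarrow> \<exists>u. chain_word m alg (phi g k - 2) (S i) (Y i) u"
      by auto
    have "S ` {..<K} \<subseteq> Pow \<A>" using S(1) by auto
    then have "card (S ` {..<K}) \<le> card (Pow \<A>)" using fin by (intro card_mono) auto
    then have "\<not> inj_on S {..<K}" using card_image[of S "{..<K}"] by (auto simp: K_def)
    then obtain i i' where i: "i < K" "i' < K" "i \<noteq> i'" "S i = S i'"
      by (auto simp: inj_on_def)
    obtain u u' where u: "chain_word m alg (phi g k - 2) (S i) (Y i) u"
      "chain_word m alg (phi g k - 2) (S i) (Y i') u'"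
      using S(3)[OF i(1)] S(3)[OF i(2)] i(4) by auto
    \<comment> \<open>Natural subtraction loses nothing here because \<open>phi\<close> never drops
      below 2.\<close>
    have e: "phi g k - 2 + 2 = phi g k" using phi_ge_2[of g k] by simp
    obtain G v where G: "feasible G" "election_index G \<le> phi g k" "adv G \<notin> S i"
      "chain_word m alg (g (phi g k) + 1) (insert (adv G) (S i)) (Y i \<union> Y i') v"
      using chain_word_step[OF LE g _ _ Y(3)[OF i(1,2,3)] u] Y(1)[OF i(1)] Y(1)[OF i(2)] X(1)
      unfolding e by blast
    have "adv G \<in> \<A>" using adv[OF G(1)] G(2) Suc.prems[of k] by simp
    moreover have "card (insert (adv G) (S i)) = Suc k"
      using G(3) S(1,2)[OF i(1)] fin finite_subset by (metis card_insert_disjoint)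
    moreover have "chain_word m alg (phi g (Suc k) - 2) (insert (adv G) (S i)) X v"
      using G(4) Y(1)[OF i(1)] Y(1)[OF i(2)] unfolding chain_word_def by auto
    ultimately show ?thesis using S(1)[OF i(1)] by (intro exI[of _ "insert (adv G) (S i)"]) auto
  qed
  then show ?case by (intro exI[of _ "K * b"]) simp
qed

text \<open>Fewer than \<open>2 ^ L\<close> strings are shorter than \<open>L\<close>. If all
  advices up to index \<alpha> were among them, a chain of length \<open>2 ^ L\<close> would use
  more advices than exist.\<close>

lemma long_advice:
  assumes LE: "LE_in_time adv alg (\<lambda>D \<phi>. D + g \<phi>)" and g: "mono g" "\<And>x. x \<le> g x"
    and le: "phi g (2 ^ L) \<le> \<alpha>"
  shows "\<exists>G. feasible G \<and> election_index G \<le> \<alpha> \<and> length (adv G) \<ge> L"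
proof (rule ccontr)
  assume no: "\<not> ?thesis"
  define \<A> where "\<A> = {A :: bool list. set A \<subseteq> UNIV \<and> length A < L}"
  have \<A>: "\<A> = (\<Union>l<L. {A. set A \<subseteq> UNIV \<and> length A = l})" by (auto simp: \<A>_def)
  have fin: "finite \<A>" unfolding \<A> by (intro finite_UN_I finite_lists_length_eq) auto
  have "card \<A> \<le> (\<Sum>l<L. card {A :: bool list. set A \<subseteq> UNIV \<and> length A = l})"
    unfolding \<A> by (rule card_UN_le) simp
  also have "\<dots> = (\<Sum>l<L. 2 ^ l)" by (subst card_lists_length_eq) auto
  also have "\<dots> < 2 ^ L" by (induction L) auto
  finally have card: "card \<A> < 2 ^ L" .
  have "adv G \<in> \<A>" if "feasible G" "election_index G \<le> \<alpha>" for G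
    using no that by (auto simp: \<A>_def not_le)
  moreover have "phi g i \<le> \<alpha>" if "i < 2 ^ L" for i
    using phi_mono[OF g(2), of i "2 ^ L"] that le by simp
  ultimately obtain b where b: "\<And>m X. X \<subseteq> {..<m} \<Longrightarrow> card X \<ge> b \<Longrightarrow>
    (\<exists>S \<subseteq> \<A>. card S = 2 ^ L \<and> (\<exists>u. chain_word m alg (phi g (2 ^ L) - 2) S X u))"
    using chain_words_exist[OF LE g fin, of \<alpha> "2 ^ L"] by blast
  obtain S where "S \<subseteq> \<A>" "card S = 2 ^ L" using b[of "{..<b}" b] by auto
  then show False using card card_mono[OF fin] by (metis not_le)
qed

section \<open>Asymptotics\<close>

lemma sqrt_dominated:
  fixes x K :: real
  assumes "0 \<le> K" "(2 * K + 1)\<^sup>2 \<le> x"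
  shows "K + K * sqrt x \<le> x"
proof -
  have x: "0 \<le> x" using assms(2) by (meson order_trans zero_le_power2)
  have s: "2 * K + 1 \<le> sqrt x" using assms by (intro real_le_rsqrt)
  then have "1 \<le> sqrt x" using assms(1) by linarith
  then have "K * 1 \<le> K * sqrt x" using assms(1) by (rule mult_left_mono)
  moreover have "(2 * K + 1) * sqrt x \<le> sqrt x * sqrt x" using s x by (intro mult_right_mono) auto
  moreover have "sqrt x * sqrt x = x" "0 \<le> sqrt x" using x by simp_all
  ultimately show ?thesis unfolding distrib_right by linarith
qed

text \<open>Asking for half of log h bits keeps the number of rounds below 2 sqrt h. The gap between
  sqrt h and h absorbs every constant coming from \<open>g\<close>, collected in
  \<open>K\<close>.\<close>

lemma advice_lower_boundI:
  fixes h :: "nat \<Rightarrow> real"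
  assumes g: "mono g" "\<And>x. x \<le> g x" and K: "0 \<le> K"
    and h: "filterlim h at_top sequentially"
    and phi: "\<And>\<alpha> N. 2 \<le> \<alpha> \<Longrightarrow> 1 \<le> h \<alpha> \<Longrightarrow> real N \<le> 2 * sqrt (h \<alpha>) \<Longrightarrow>
      K + K * sqrt (h \<alpha>) \<le> h \<alpha> \<Longrightarrow> phi g N \<le> \<alpha>"
  shows "advice_lower_bound (\<lambda>D \<phi>. D + g \<phi>) (\<lambda>\<alpha>. log 2 (h \<alpha>))"
proof -
  have "eventually (\<lambda>\<alpha>. 2 \<le> \<alpha> \<and> (2 * K + 1)\<^sup>2 \<le> h \<alpha>) sequentially"
    using h by (intro eventually_conj eventually_ge_at_top) (auto simp: filterlim_at_top)
  then obtain \<alpha>0 where \<alpha>0: "\<And>\<alpha>. \<alpha> \<ge> \<alpha>0 \<Longrightarrow> 2 \<le> \<alpha> \<and> (2 * K + 1)\<^sup>2 \<le> h \<alpha>"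
    by (auto simp: eventually_sequentially)
  have "\<exists>G. feasible G \<and> election_index G \<le> \<alpha> \<and> real (length (adv G)) \<ge> 1 / 2 * log 2 (h \<alpha>)"
    if \<alpha>: "\<alpha> \<ge> \<alpha>0" and LE: "LE_in_time adv alg (\<lambda>D \<phi>. D + g \<phi>)" for \<alpha> adv alg
  proof -
    have big: "2 \<le> \<alpha>" "(2 * K + 1)\<^sup>2 \<le> h \<alpha>" using \<alpha>0[OF \<alpha>] by auto
    have "1 \<le> (2 * K + 1)\<^sup>2" using K by (intro one_le_power) auto
    then have h1: "1 \<le> h \<alpha>" using big by linarith
    \<comment> \<open>Rounding up secures the required length and costs at most a factor 2 in
      \<open>2 ^ L\<close>.\<close>
    define L where "L = nat \<lceil>log 2 (h \<alpha>) / 2\<rceil>"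
    have log0: "0 \<le> log 2 (h \<alpha>)" using h1 by simp
    then have L: "log 2 (h \<alpha>) / 2 \<le> real L" "real L \<le> log 2 (h \<alpha>) / 2 + 1"
      unfolding L_def by linarith+
    have "real (2 ^ L) = 2 powr real L" by (simp add: powr_realpow)
    also have "\<dots> \<le> 2 powr (log 2 (h \<alpha>) * (1 / 2) + 1)" using L by (intro powr_mono) auto
    also have "\<dots> = (2 powr log 2 (h \<alpha>)) powr (1 / 2) * 2" by (simp add: powr_add powr_powr)
    also have "\<dots> = 2 * sqrt (h \<alpha>)" using h1 by (simp add: powr_half_sqrt)
    finally have "phi g (2 ^ L) \<le> \<alpha>"
      using phi[OF big(1) h1] sqrt_dominated[OF K big(2)] by blast
    then obtain G where "feasible G" "election_index G \<le> \<alpha>" "length (adv G) \<ge> L"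
      using long_advice[OF LE g] by blast
    then show ?thesis using L by (intro exI[of _ G]) auto
  qed
  then show ?thesis unfolding advice_lower_bound_def
    by (intro exI[of _ "1 / 2"] conjI exI[of _ \<alpha>0] allI impI) auto
qed

lemma filterlim_log2: "filterlim (log (2::real)) at_top at_top"
proof -
  have "log (2::real) = (\<lambda>x. (1 / ln 2) * ln x)" by (auto simp: log_def)
  then show ?thesis
    by (simp only:) (intro filterlim_tendsto_pos_mult_at_top[OF tendsto_const _ ln_at_top], simp)
qed

section \<open>Growth of \<open>phi\<close> for the four time bounds\<close>

lemma phi_add: "phi (\<lambda>\<phi>. \<phi> + c) N = 2 + N * (c + 3)"
  by (induction N) auto

text \<open>Since \<open>phi\<close> is at least 2, the additive 3 is absorbed by raising the factor
  to \<open>c + 3\<close>.\<close>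

lemma phi_mult_le: "phi (\<lambda>\<phi>. c * \<phi>) N \<le> 2 * (c + 3) ^ N"
proof (induction N)
  case (Suc N)
  have "c * phi (\<lambda>\<phi>. c * \<phi>) N + 3 \<le> (c + 3) * phi (\<lambda>\<phi>. c * \<phi>) N"
    using phi_ge_2[of "\<lambda>\<phi>. c * \<phi>" N] by (simp add: algebra_simps)
  also have "\<dots> \<le> (c + 3) * (2 * (c + 3) ^ N)" by (intro mult_left_mono Suc) simp
  finally show ?case by (simp add: mult_ac)
qed simp

text \<open>For x at least 2 the additive 3 is absorbed by two more factors x, which turns the
  recursion into repeated raising to the power \<open>c + 2\<close>.\<close>

lemma phi_power_le: "phi (\<lambda>\<phi>. \<phi> ^ c) N \<le> 2 ^ (c + 2) ^ N"
proof (induction N)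
  case (Suc N)
  let ?x = "phi (\<lambda>\<phi>. \<phi> ^ c) N"
  have x: "2 \<le> ?x" by (rule phi_ge_2)
  then have "4 \<le> ?x\<^sup>2" using power_mono[of 2 ?x 2] by simp
  then have "?x ^ c * 4 \<le> ?x ^ c * ?x\<^sup>2" by (rule mult_left_mono) simp
  moreover have "1 \<le> ?x ^ c" using x by (intro one_le_power) simp
  ultimately have "?x ^ c + 3 \<le> ?x ^ c * ?x\<^sup>2" by linarith
  then have "?x ^ c + 3 \<le> ?x ^ (c + 2)" by (simp only: power_add)
  also have "\<dots> \<le> (2 ^ (c + 2) ^ N) ^ (c + 2)" by (intro power_mono Suc) simp
  also have "\<dots> = 2 ^ (c + 2) ^ Suc N" by (simp only: power_mult[symmetric] power_Suc mult_ac)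
  finally show ?case by simp
qed simp

primrec tower :: "nat \<Rightarrow> nat" where
  "tower 0 = 1"
| "tower (Suc k) = 2 ^ tower k"

lemma tower_gt: "k < tower k"
proof (induction k)
  case (Suc k)
  have "tower k < 2 ^ tower k" by (rule less_exp)
  then show ?case using Suc unfolding tower.simps by linarith
qed simp

text \<open>The claim is strengthened by the factor \<open>c\<close> and the summand 2: the factor
  turns powers of \<open>c\<close> into powers of 2, and the summand pays for the constants. Each
  round costs two levels of the tower.\<close>

lemma phi_exp_le:
  assumes "c > 1"
  shows "c * phi (\<lambda>\<phi>. c ^ \<phi>) N + 2 \<le> tower (2 * N + 2 * c + 2)"
proof (induction N)
  case 0
  then show ?case using tower_gt[of "2 * c + 2"] by (simp add: mult.commute)
next
  case (Suc N)
  let ?x = "phi (\<lambda>\<phi>. c ^ \<phi>) N"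
  let ?y = "c * ?x + 2"
  have cy: "c + 2 \<le> ?y" using phi_ge_2[of "\<lambda>\<phi>. c ^ \<phi>" N] by simp
  have "c ^ ?x \<le> (2 ^ c) ^ ?x" by (intro power_mono) (simp_all add: less_imp_le less_exp)
  also have "\<dots> = 2 ^ (c * ?x)" by (simp add: power_mult)
  finally have "c ^ ?x + 3 \<le> 2 ^ (c * ?x) + 3" by simp
  also have "\<dots> \<le> 2 ^ ?y" using one_le_power[of "2::nat" "c * ?x"] by simp
  finally have "c * (c ^ ?x + 3) + 2 \<le> c * 2 ^ ?y + 2 * 2 ^ ?y"
    by (intro add_mono mult_left_mono) auto
  also have "\<dots> = (c + 2) * 2 ^ ?y" by (simp add: algebra_simps)
  also have "\<dots> \<le> ?y * 2 ^ ?y" using cy by (rule mult_right_mono) simp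
  also have "\<dots> \<le> 2 ^ (2 ^ ?y)"
  proof -
    have "?y \<le> 2 ^ (?y - 1)" using less_exp[of "?y - 1"] by simp
    then have "?y + ?y \<le> 2 * 2 ^ (?y - 1)" by linarith
    also have "\<dots> = 2 ^ ?y" by (simp flip: power_Suc)
    finally have "(2::nat) ^ (?y + ?y) \<le> 2 ^ (2 ^ ?y)" by (intro power_increasing) auto
    moreover have "?y * 2 ^ ?y \<le> 2 ^ (?y + ?y)"
      unfolding power_add using less_exp[of ?y] by (intro mult_right_mono) auto
    ultimately show ?thesis by (rule order_trans[rotated])
  qed
  also have "\<dots> \<le> 2 ^ (2 ^ tower (2 * N + 2 * c + 2))" using Suc by (intro power_increasing) auto
  also have "\<dots> = tower (2 * Suc N + 2 * c + 2)" by simp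
  finally show ?case by simp
qed

lemma iterated_log_le_1:
  assumes "x \<le> real (tower j)"
  shows "\<exists>k \<le> j. ((log 2) ^^ k) x \<le> 1"
  using assms
proof (induction j arbitrary: x)
  case (Suc j)
  show ?case
  proof (cases "x \<le> 1")
    case True
    then show ?thesis by (intro exI[of _ 0]) simp
  next
    case False
    then have "log 2 x \<le> log 2 (2 ^ tower j)" using Suc.prems by (subst log_le_cancel_iff) auto
    then have "log 2 x \<le> real (tower j)" by simp
    from Suc.IH[OF this] obtain k where "k \<le> j" "((log 2) ^^ k) (log 2 x) \<le> 1" by blast
    then show ?thesis by (intro exI[of _ "Suc k"]) (simp add: funpow_swap1)
  qed
qed auto

lemma iterated_log_le_1D:
  assumes "((log 2) ^^ k) x \<le> 1"
  shows "x \<le> real (tower k)"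
  using assms
proof (induction k arbitrary: x)
  case (Suc k)
  show ?case
  \<comment> \<open>For x at most 1 the logarithm gives no usable bound, but every tower is at least
    1.\<close>
  proof (cases "x \<le> 1")
    case True
    moreover have "1 \<le> real (tower (Suc k))" using tower_gt[of "Suc k"] by linarith
    ultimately show ?thesis by linarith
  next
    case False
    have "log 2 x \<le> real (tower k)" using Suc.prems by (intro Suc.IH) (simp add: funpow_swap1)
    then have "x \<le> 2 powr real (tower k)" using False by (simp add: log_le_iff)
    then show ?thesis by (simp add: powr_realpow)
  qed
qed auto

text \<open>Taking a logarithm removes one level of the tower. Since towers exceed every real, some
  iterate always drops to 1, so the \<open>LEAST\<close> in \<open>log_star\<close> is
  attained.\<close>

lemma log_star_le_iff: "log_star x \<le> j \<longleftrightarrow> x \<le> real (tower j)"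
proof
  assume "x \<le> real (tower j)"
  then show "log_star x \<le> j"
    using iterated_log_le_1 Least_le unfolding log_star_def by (meson order_trans)
next
  assume j: "log_star x \<le> j"
  have mono: "tower a \<le> tower b" if "a \<le> b" for a b
    using that by (rule lift_Suc_mono_le[rotated]) (simp add: less_imp_le less_exp)
  obtain b where "x \<le> real b" using real_arch_simple by blast
  then have "x \<le> real (tower b)" using tower_gt[of b] by linarith
  then have "\<exists>k. ((log 2) ^^ k) x \<le> 1" using iterated_log_le_1 by blast
  then have "((log 2) ^^ log_star x) x \<le> 1" unfolding log_star_def by (rule LeastI_ex)
  then have "x \<le> real (tower (log_star x))" by (rule iterated_log_le_1D)
  then show "x \<le> real (tower j)" using mono[OF j] by (meson of_nat_mono order_trans)
qed

lemma filterlim_log_star: "filterlim (\<lambda>\<alpha>. real (log_star (real \<alpha>))) at_top sequentially"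
  unfolding filterlim_at_top
proof
  fix Z :: real
  obtain j where j: "Z \<le> real j" using real_arch_simple by blast
  have "Z \<le> real (log_star (real \<alpha>))" if "\<alpha> > tower j" for \<alpha>
    using log_star_le_iff[of "real \<alpha>" j] that j by linarith
  then show "eventually (\<lambda>\<alpha>. Z \<le> real (log_star (real \<alpha>))) sequentially"
    by (meson eventually_gt_at_top eventually_mono)
qed

theorem theorem5:
  fixes c :: nat
  assumes "c > 1"
  shows "advice_lower_bound (\<lambda>D \<phi>. D + \<phi> + c) (\<lambda>\<alpha>. log 2 (real \<alpha>))
       \<and> advice_lower_bound (\<lambda>D \<phi>. D + c * \<phi>) (\<lambda>\<alpha>. log 2 (log 2 (real \<alpha>)))
       \<and> advice_lower_bound (\<lambda>D \<phi>. D + \<phi> ^ c) (\<lambda>\<alpha>. log 2 (log 2 (log 2 (real \<alpha>))))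
       \<and> advice_lower_bound (\<lambda>D \<phi>. D + c ^ \<phi>) (\<lambda>\<alpha>. log 2 (real (log_star (real \<alpha>))))"
proof (intro conjI)
  have c: "1 \<le> c" using assms by simp
  have log: "filterlim (\<lambda>\<alpha>. log 2 (real \<alpha>)) at_top sequentially"
    by (rule filterlim_compose[OF filterlim_log2 filterlim_real_sequentially])
  have loglog: "filterlim (\<lambda>\<alpha>. log 2 (log 2 (real \<alpha>))) at_top sequentially"
    by (rule filterlim_compose[OF filterlim_log2 log])
  have "phi (\<lambda>\<phi>. \<phi> + c) N \<le> \<alpha>"
    if "real N \<le> 2 * sqrt (real \<alpha>)"
      "2 * (real c + 3) + 2 * (real c + 3) * sqrt (real \<alpha>) \<le> real \<alpha>" for \<alpha> N
  proof -
    have "real N * (real c + 3) \<le> 2 * sqrt (real \<alpha>) * (real c + 3)"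
      using that(1) by (rule mult_right_mono) simp
    then have "real (2 + N * (c + 3)) \<le> real \<alpha>" using that(2) by (simp add: algebra_simps)
    then show ?thesis unfolding phi_add by linarith
  qed
  then have "advice_lower_bound (\<lambda>D \<phi>. D + (\<phi> + c)) (\<lambda>\<alpha>. log 2 (real \<alpha>))"
    by (intro advice_lower_boundI[where K = "2 * (real c + 3)"] filterlim_real_sequentially)
      (auto intro: monoI)
  then show "advice_lower_bound (\<lambda>D \<phi>. D + \<phi> + c) (\<lambda>\<alpha>. log 2 (real \<alpha>))"
    by (simp add: add.assoc)
  show "advice_lower_bound (\<lambda>D \<phi>. D + c * \<phi>) (\<lambda>\<alpha>. log 2 (log 2 (real \<alpha>)))"
  \<comment> \<open>\<open>K\<close> comes from taking the logarithm of
    \<open>2 * (c + 3) ^ N\<close> with N at most 2 sqrt h.\<close>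
  proof (rule advice_lower_boundI[where K = "2 * log 2 (real c + 3)", OF _ _ _ log])
    fix \<alpha> N :: nat
    let ?h = "log 2 (real \<alpha>)"
    assume \<alpha>: "2 \<le> \<alpha>" and N: "real N \<le> 2 * sqrt ?h"
      and K: "2 * log 2 (real c + 3) + 2 * log 2 (real c + 3) * sqrt ?h \<le> ?h"
    have one: "1 \<le> log 2 (real c + 3)" by (simp add: le_log_iff)
    then have "real N * log 2 (real c + 3) \<le> 2 * sqrt ?h * log 2 (real c + 3)"
      using N by (intro mult_right_mono) auto
    then have "1 + real N * log 2 (real c + 3) \<le> ?h" using K one by (simp only: mult_ac)
    moreover have "log 2 (2 * (real c + 3) ^ N) = 1 + real N * log 2 (real c + 3)"
      by (simp add: log_mult log_nat_power)
    ultimately have "log 2 (2 * (real c + 3) ^ N) \<le> ?h" by simp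
    then have "2 * (real c + 3) ^ N \<le> real \<alpha>" using \<alpha> by (subst (asm) log_le_cancel_iff) auto
    then have "real (2 * (c + 3) ^ N) \<le> real \<alpha>" by simp
    then show "phi (\<lambda>\<phi>. c * \<phi>) N \<le> \<alpha>" using phi_mult_le[of c N] by linarith
  qed (use c in \<open>auto intro: monoI\<close>)
  show "advice_lower_bound (\<lambda>D \<phi>. D + \<phi> ^ c) (\<lambda>\<alpha>. log 2 (log 2 (log 2 (real \<alpha>))))"
  \<comment> \<open>The same after two logarithms of \<open>2 ^ (c + 2) ^ N\<close>.\<close>
  proof (rule advice_lower_boundI[where K = "2 * log 2 (real c + 2)", OF _ _ _ loglog])
    fix \<alpha> N :: nat
    let ?h = "log 2 (log 2 (real \<alpha>))"
    assume \<alpha>: "2 \<le> \<alpha>" and N: "real N \<le> 2 * sqrt ?h"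
      and K: "2 * log 2 (real c + 2) + 2 * log 2 (real c + 2) * sqrt ?h \<le> ?h"
    have log1: "1 \<le> log 2 (real \<alpha>)" using \<alpha> by (simp add: le_log_iff)
    have one: "1 \<le> log 2 (real c + 2)" by (simp add: le_log_iff)
    then have "real N * log 2 (real c + 2) \<le> 2 * sqrt ?h * log 2 (real c + 2)"
      using N by (intro mult_right_mono) auto
    then have "real N * log 2 (real c + 2) \<le> ?h" using K one by (simp only: mult_ac)
    then have "log 2 ((real c + 2) ^ N) \<le> ?h" by (simp add: log_nat_power)
    then have "(real c + 2) ^ N \<le> log 2 (real \<alpha>)" using log1 by (subst (asm) log_le_cancel_iff) auto
    then have "real ((c + 2) ^ N) \<le> log 2 (real \<alpha>)" by (simp add: add.commute)
    then have "2 powr real ((c + 2) ^ N) \<le> real \<alpha>" using \<alpha> by (subst (asm) le_log_iff) auto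
    then have "real (2 ^ (c + 2) ^ N) \<le> real \<alpha>" by (simp only: powr_realpow) simp
    then show "phi (\<lambda>\<phi>. \<phi> ^ c) N \<le> \<alpha>" using phi_power_le[of c N] by linarith
  next
    show "x \<le> x ^ c" for x :: nat using c by (cases "x = 0") (auto intro: self_le_power)
  qed (auto intro: monoI power_mono simp: le_log_iff)
  show "advice_lower_bound (\<lambda>D \<phi>. D + c ^ \<phi>) (\<lambda>\<alpha>. log 2 (real (log_star (real \<alpha>))))"
  \<comment> \<open>\<open>K\<close> is chosen so that the tower height
    \<open>2 * N + 2 * c + 2\<close> stays strictly below h; then \<alpha> exceeds that
    tower.\<close>
  proof (rule advice_lower_boundI[where K = "2 * real c + 4", OF _ _ _ filterlim_log_star])
    fix \<alpha> N :: nat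
    let ?h = "real (log_star (real \<alpha>))"
    assume h1: "1 \<le> ?h" and N: "real N \<le> 2 * sqrt ?h"
      and K: "2 * real c + 4 + (2 * real c + 4) * sqrt ?h \<le> ?h"
    have "4 * sqrt ?h \<le> (2 * real c + 4) * sqrt ?h" by (rule mult_right_mono) auto
    then have "real (2 * N + 2 * c + 2) < ?h" using N K by simp
    then have "\<not> log_star (real \<alpha>) \<le> 2 * N + 2 * c + 2" by linarith
    then have "tower (2 * N + 2 * c + 2) < \<alpha>" by (simp add: log_star_le_iff not_le del: tower.simps)
    then have "c * phi (\<lambda>\<phi>. c ^ \<phi>) N \<le> \<alpha>" using phi_exp_le[OF assms, of N] by linarith
    moreover have "1 * phi (\<lambda>\<phi>. c ^ \<phi>) N \<le> c * phi (\<lambda>\<phi>. c ^ \<phi>) N"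
      using c by (rule mult_right_mono) simp
    ultimately show "phi (\<lambda>\<phi>. c ^ \<phi>) N \<le> \<alpha>" by linarith
  next
    show "x \<le> c ^ x" for x using power_mono[of 2 c x] less_exp[of x] assms by simp
    show "mono ((^) c)" using c by (intro monoI power_increasing)
  qed simp
qed

end
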